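(* Let $\hat\theta$ denote any one of the estimators $\hat\theta_H$, $\hat\theta_S$, $\hat\theta_{SCAD}$, and write $F_{n,\theta}$ for the cdf of $n^{1/2}(\hat\theta-\theta)$ under $P_{n,\theta}$. Let $0<\eta_n<\infty$ and let $t\in\mathbb{R}$ be arbitrary. Then every estimator $\hat F_n(t)$ of $F_{n,\theta}(t)$ satisfies $$\sup_{|\theta|<c/n^{1/2}}P_{n,\theta}\left(\left|\hat F_n(t)-F_{n,\theta}(t)\right|>\varepsilon\right)\ge\frac12$$ for each $\varepsilon<(\Phi(t+n^{1/2}\eta_n)-\Phi(t-n^{1/2}\eta_n))/2$, for each $c>|t|$, and for each fixed sample size $n$. If $\eta_n$ satisfies $\eta_n\to0$ and $n^{1/2}\eta_n\to e$ as $n\to\infty$ with $0\le e\le\infty$, we thus have $$\liminf_{n\to\infty}\inf_{\hat F_n(t)}\sup_{|\theta|<c/n^{1/2}}P_{n,\theta}\left(\left|\hat F_n(t)-F_{n,\theta}(t)\right|>\varepsilon\right)\ge\frac12$$ for each $\varepsilon<(\Phi(t+e)-\Phi(t-e))/2$ and for each $c>|t|$, where the infimum extends over all estimators $\hat F_n(t)$.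
   Context: For each $n\ge1$ and $\theta\in\mathbb{R}$, $P_{n,\theta}$ is the probability measure under which $y_1,\dots,y_n$ are independent and each $N(\theta,1)$-distributed; $\bar y=n^{-1}\sum_{t=1}^n y_t$. $\eta_n$ is a positive real tuning parameter. $\boldsymbol{1}(\cdot)$ is the indicator function, $z_+=\max\{z,0\}$, and $\mathrm{sign}(x)=-1,0,1$ for $x<0$, $x=0$, $x>0$. The estimators (at sample size $n$) are: hard-thresholding $\hat\theta_H=\bar y\,\boldsymbol{1}(|\bar y|>\eta_n)$; soft-thresholding (LASSO) $\hat\theta_S=\mathrm{sign}(\bar y)(|\bar y|-\eta_n)_+$; and, for a fixed constant $a>2$, SCAD: $\hat\theta_{SCAD}=\mathrm{sign}(\bar y)(|\bar y|-\eta_n)_+$ if $|\bar y|\le 2\eta_n$, $\hat\theta_{SCAD}=\{(a-1)\bar y-\mathrm{sign}(\bar y)a\eta_n\}/(a-2)$ if $2\eta_n<|\bar y|\le a\eta_n$, and $\hat\theta_{SCAD}=\bar y$ if $|\bar y|>a\eta_n$. $\Phi$ is the standard normal cdf, with $\Phi(-\infty)=0$, $\Phi(\infty)=1$. An estimator $\hat F_n(t)$ is any real-valued measurable function of $y_1,\dots,y_n$ (no consistency is assumed). *)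

theory Defs
  imports "HOL-Probability.Probability"
begin

definition sample_measure :: "nat \<Rightarrow> real \<Rightarrow> (nat \<Rightarrow> real) measure" where
  "sample_measure n \<theta> = (\<Pi>\<^sub>M i\<in>{1..n}. density lborel (normal_density \<theta> 1))"

(* All the measures sample_measure n \<theta> have the same sigma-algebra as this product of
   Borel sigma-algebras, so measurability does not depend on \<theta>. *)
definition estimators :: "nat \<Rightarrow> ((nat \<Rightarrow> real) \<Rightarrow> real) set" where
  "estimators n = borel_measurable (\<Pi>\<^sub>M i\<in>{1..n}. borel)"

definition sample_mean :: "nat \<Rightarrow> (nat \<Rightarrow> real) \<Rightarrow> real" where
  "sample_mean n y = (\<Sum>i=1..n. y i) / real n"

definition hard_est :: "nat \<Rightarrow> real \<Rightarrow> (nat \<Rightarrow> real) \<Rightarrow> real" where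
  "hard_est n \<eta> y = sample_mean n y * of_bool (\<bar>sample_mean n y\<bar> > \<eta>)"

definition soft_est :: "nat \<Rightarrow> real \<Rightarrow> (nat \<Rightarrow> real) \<Rightarrow> real" where
  "soft_est n \<eta> y = sgn (sample_mean n y) * max (\<bar>sample_mean n y\<bar> - \<eta>) 0"

definition scad_est :: "real \<Rightarrow> nat \<Rightarrow> real \<Rightarrow> (nat \<Rightarrow> real) \<Rightarrow> real" where
  "scad_est a n \<eta> y = (let m = sample_mean n y in
     if \<bar>m\<bar> \<le> 2 * \<eta> then sgn m * max (\<bar>m\<bar> - \<eta>) 0
     else if \<bar>m\<bar> \<le> a * \<eta> then ((a - 1) * m - sgn m * a * \<eta>) / (a - 2)
     else m)"

definition est_cdf ::
  "(nat \<Rightarrow> real \<Rightarrow> (nat \<Rightarrow> real) \<Rightarrow> real) \<Rightarrow> real \<Rightarrow> nat \<Rightarrow> real \<Rightarrow> real \<Rightarrow> real" where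
  "est_cdf est \<eta> n \<theta> t =
     cdf (distr (sample_measure n \<theta>) borel (\<lambda>y. sqrt (real n) * (est n \<eta> y - \<theta>))) t"

definition error_prob ::
  "(nat \<Rightarrow> real \<Rightarrow> (nat \<Rightarrow> real) \<Rightarrow> real) \<Rightarrow> real \<Rightarrow> nat \<Rightarrow> real \<Rightarrow> real \<Rightarrow> ((nat \<Rightarrow> real) \<Rightarrow> real) \<Rightarrow> real \<Rightarrow> real"
  where
  "error_prob est \<eta> n \<theta> t Fhat \<epsilon> =
     measure (sample_measure n \<theta>)
       {y \<in> space (sample_measure n \<theta>). \<bar>Fhat y - est_cdf est \<eta> n \<theta> t\<bar> > \<epsilon>}"

definition Phi :: "ereal \<Rightarrow> real" where
  "Phi z = (case z of ereal x \<Rightarrow> cdf std_normal_distribution x | PInfty \<Rightarrow> 1 | MInfty \<Rightarrow> 0)"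

end

theory Submission imports Defs begin

text \<open>
  As a function of \<open>\<theta>\<close>, the cdf \<open>F(t)\<close> of \<open>sqrt n (est - \<theta>)\<close> jumps at \<open>\<theta>0 = - t / sqrt n\<close>, because \<open>est\<close>
  vanishes whenever the sample mean lies in \<open>[-\<eta>, \<eta>]\<close>: just to the right of \<open>\<theta>0\<close> it is at least
  about \<open>\<Phi>(t + sqrt n \<eta>)\<close>, just to the left at most about \<open>\<Phi>(t - sqrt n \<eta>)\<close>. Let \<open>q\<close> be the midpoint
  of these two values and \<open>B\<close> the event that the estimate of \<open>F(t)\<close> is at most \<open>q\<close>. Then \<open>B\<close> forces an
  error larger than \<open>\<epsilon>\<close> for \<open>\<theta>\<close> slightly above \<open>\<theta>0\<close>, and its complement does so for \<open>\<theta>\<close> slightly below.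
  Since \<open>P\<^sub>\<theta>(B)\<close> is continuous in \<open>\<theta>\<close>, the supremum of the error probabilities dominates both
  \<open>P(B)\<close> and \<open>1 - P(B)\<close> at \<open>\<theta>0\<close>, one of which is at least one half.
\<close>

section \<open>Product densities and continuity in the parameter\<close>

text \<open>It suffices to compare the two measures on boxes \<open>PiE I A\<close>, where Tonelli
  turns the integral of a product into a product of integrals. This puts the sample measures for all
  \<theta> over one common base measure.\<close>

lemma PiM_density:
  fixes f :: "'i \<Rightarrow> 'a \<Rightarrow> ennreal"
  assumes "finite I" and M: "\<And>i. sigma_finite_measure (M i)"
    and D: "\<And>i. sigma_finite_measure (density (M i) (f i))"
    and f [measurable]: "\<And>i. f i \<in> borel_measurable (M i)"
  shows "PiM I (\<lambda>i. density (M i) (f i)) = density (PiM I M) (\<lambda>x. \<Prod>i\<in>I. f i (x i))"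
proof -
  interpret M: product_sigma_finite M
    using M by (simp add: product_sigma_finite_def)
  interpret D: product_sigma_finite "\<lambda>i. density (M i) (f i)"
    using D by (simp add: product_sigma_finite_def)
  have "density (PiM I M) (\<lambda>x. \<Prod>i\<in>I. f i (x i)) = PiM I (\<lambda>i. density (M i) (f i))"
  proof (rule D.PiM_eqI[OF \<open>finite I\<close>])
    show "sets (density (PiM I M) (\<lambda>x. \<Prod>i\<in>I. f i (x i))) = sets (PiM I (\<lambda>i. density (M i) (f i)))"
      by (simp cong: sets_PiM_cong)
  next
    fix A assume "\<And>i. i \<in> I \<Longrightarrow> A i \<in> sets (density (M i) (f i))"
    then have A: "\<And>i. i \<in> I \<Longrightarrow> A i \<in> sets (M i)" by simp
    have "emeasure (density (PiM I M) (\<lambda>x. \<Prod>i\<in>I. f i (x i))) (PiE I A)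
        = (\<integral>\<^sup>+x. (\<Prod>i\<in>I. f i (x i)) * indicator (PiE I A) x \<partial>PiM I M)"
      using A \<open>finite I\<close> by (intro emeasure_density) (auto intro!: sets_PiM_I_finite)
    also have "\<dots> = (\<integral>\<^sup>+x. (\<Prod>i\<in>I. f i (x i) * indicator (A i) (x i)) \<partial>PiM I M)"
      using \<open>finite I\<close>
      \<comment> \<open>The indicator of the box splits into coordinate indicators because
        \<open>x\<close> is extensional on the product space.\<close>
      by (intro nn_integral_cong)
        (auto simp: prod.distrib space_PiM PiE_iff indicator_def prod_zero_iff extensional_def)
    also have "\<dots> = (\<Prod>i\<in>I. \<integral>\<^sup>+x. f i x * indicator (A i) x \<partial>M i)"
      using A \<open>finite I\<close> by (intro M.product_nn_integral_prod) auto
    also have "\<dots> = (\<Prod>i\<in>I. emeasure (density (M i) (f i)) (A i))"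
      using A by (intro prod.cong) (auto simp: emeasure_density)
    finally show "emeasure (density (PiM I M) (\<lambda>x. \<Prod>i\<in>I. f i (x i))) (PiE I A)
        = (\<Prod>i\<in>I. emeasure (density (M i) (f i)) (A i))" .
  qed
  then show ?thesis ..
qed

lemma sets_sample_measure: "sets (sample_measure n \<theta>) = sets (\<Pi>\<^sub>M i\<in>{1..n}. borel)"
  unfolding sample_measure_def by (intro sets_PiM_cong) auto

lemma prob_space_sample_measure: "prob_space (sample_measure n \<theta>)"
  unfolding sample_measure_def by (intro prob_space_PiM prob_space_normal_density) simp

lemma sample_measure_eq_density:
  "sample_measure n \<theta>
    = density (\<Pi>\<^sub>M i\<in>{1..n}. lborel) (\<lambda>y. ennreal (\<Prod>i\<in>{1..n}. normal_density \<theta> 1 (y i)))"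
proof -
  have "sigma_finite_measure (density lborel (normal_density \<theta> 1))"
    by (rule prob_space_imp_sigma_finite[OF prob_space_normal_density]) simp
  then have "sample_measure n \<theta>
      = density (\<Pi>\<^sub>M i\<in>{1..n}. lborel) (\<lambda>y. \<Prod>i\<in>{1..n}. ennreal (normal_density \<theta> 1 (y i)))"
    unfolding sample_measure_def
    by (intro PiM_density) (auto simp: lborel.sigma_finite_measure_axioms)
  then show ?thesis
    by (simp add: prod_ennreal)
qed

text \<open>Supplies an envelope that does not depend on \<theta>: doubling the variance leaves room
  for a shift of the mean by at most 1. The factor \<open>sqrt 2\<close> corrects the normalising
  constant, and \<open>exp (1/2)\<close> absorbs the shift.\<close>

lemma normal_density_le_wider:
  assumes "\<bar>\<theta> - \<theta>0\<bar> \<le> 1"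
  shows "normal_density \<theta> 1 x \<le> sqrt 2 * exp (1/2) * normal_density \<theta>0 (sqrt 2) x"
proof -
  have "(\<theta> - \<theta>0)\<^sup>2 \<le> 1"
    using assms by (simp add: abs_square_le_1)
  \<comment> \<open>Completing the square: with u = x - \<open>\<theta>0\<close> and d = \<theta> -
    \<open>\<theta>0\<close>, 2(u - d)^2 - u^2 = (u - 2d)^2 - 2d^2, which is at least -2.\<close>
  moreover have "0 \<le> (x - \<theta>0 - 2 * (\<theta> - \<theta>0))\<^sup>2" by simp
  ultimately have "(x - \<theta>0)\<^sup>2 \<le> 2 * (x - \<theta>)\<^sup>2 + 2"
    by (simp add: power2_eq_square algebra_simps)
  then have "- (x - \<theta>)\<^sup>2 / 2 \<le> 1/2 + - (x - \<theta>0)\<^sup>2 / 4"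
    by simp
  then have "exp (- (x - \<theta>)\<^sup>2 / 2) \<le> exp (1/2) * exp (- (x - \<theta>0)\<^sup>2 / 4)"
    by (simp flip: exp_add)
  then show ?thesis
    by (simp add: normal_density_def real_sqrt_mult field_simps flip: mult.assoc)
qed

text \<open>Dominated convergence: the joint density \<open>g\<close> is continuous in \<theta> at
  every fixed sample, and the product \<open>w\<close> of wider normal densities is an integrable
  envelope for it within distance 1 of \<open>\<theta>0\<close>.\<close>

lemma isCont_measure_sample_measure:
  assumes "B \<in> sets (\<Pi>\<^sub>M i\<in>{1..n}. borel :: real measure)"
  shows "isCont (\<lambda>\<theta>. measure (sample_measure n \<theta>) B) \<theta>0"
proof -
  define L where "L = (\<Pi>\<^sub>M i\<in>{1..n}. (lborel :: real measure))"
  define g where "g = (\<lambda>\<theta> y. \<Prod>i\<in>{1..n}. normal_density \<theta> 1 (y i))"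
  define w where "w = (\<lambda>y. \<Prod>i\<in>{1..n}. sqrt 2 * exp (1/2) * normal_density \<theta>0 (sqrt 2) (y i))"
  interpret product_sigma_finite "\<lambda>i::nat. lborel :: real measure"
    by standard
  have B [measurable]: "B \<in> sets L"
    using assms unfolding L_def by (simp cong: sets_PiM_cong)
  have g [measurable]: "g \<theta> \<in> borel_measurable L" for \<theta>
    unfolding g_def L_def by measurable
  have g_nonneg: "0 \<le> g \<theta> y" for \<theta> y
    unfolding g_def by (intro prod_nonneg) auto
  have w_int: "integrable L w"
    unfolding L_def w_def by (intro product_integrable_prod) auto
  have g_le: "norm (indicator B y * g \<theta> y) \<le> w y" if "\<bar>\<theta> - \<theta>0\<bar> \<le> 1" for \<theta> y
  proof -
    have "g \<theta> y \<le> w y"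
      unfolding g_def w_def using that by (intro prod_mono) (auto intro: normal_density_le_wider)
    with g_nonneg[of \<theta> y] show ?thesis
      by (auto simp: indicator_def)
  qed
  have meas: "measure (sample_measure n \<theta>) B = (\<integral>y. indicator B y * g \<theta> y \<partial>L)" for \<theta>
  proof -
    have "measure (sample_measure n \<theta>) B = enn2real (\<integral>\<^sup>+y. ennreal (g \<theta> y) * indicator B y \<partial>L)"
    proof -
      have "sample_measure n \<theta> = density L (\<lambda>y. ennreal (g \<theta> y))"
        by (simp only: sample_measure_eq_density g_def L_def)
      then show ?thesis
        by (simp add: measure_def emeasure_density)
    qed
    also have "\<dots> = enn2real (\<integral>\<^sup>+y. ennreal (indicator B y * g \<theta> y) \<partial>L)"
      by (intro arg_cong[where f=enn2real] nn_integral_cong) (auto simp: indicator_def)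
    also have "\<dots> = (\<integral>y. indicator B y * g \<theta> y \<partial>L)"
      by (rule integral_eq_nn_integral[symmetric]) (use g_nonneg in auto)
    finally show ?thesis .
  qed
  \<comment> \<open>Working on a ball keeps every term of the approximating sequences in the range
    where the envelope is valid.\<close>
  have "continuous_on (ball \<theta>0 1) (\<lambda>\<theta>. measure (sample_measure n \<theta>) B)"
  proof (rule continuous_on_sequentiallyI)
    fix u \<theta> assume u: "\<forall>k. u k \<in> ball \<theta>0 1" and lim: "u \<longlonglongrightarrow> \<theta>"
    show "(\<lambda>k. measure (sample_measure n (u k)) B) \<longlonglongrightarrow> measure (sample_measure n \<theta>) B"
      unfolding meas
    proof (rule integral_dominated_convergence[OF _ _ w_int])
      show "AE y in L. (\<lambda>k. indicator B y * g (u k) y) \<longlonglongrightarrow> indicator B y * g \<theta> y"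
        unfolding g_def normal_density_def by (intro AE_I2 tendsto_intros lim) auto
      show "AE y in L. norm (indicator B y * g (u k) y) \<le> w y" for k
        using u[rule_format, of k] by (intro AE_I2 g_le) (simp add: dist_real_def)
    qed measurable
  qed
  then show ?thesis
    by (rule continuous_on_interior) simp
qed

section \<open>The law of the sample mean\<close>

lemma measurable_sample_mean [measurable]:
  "sample_mean n \<in> borel_measurable (\<Pi>\<^sub>M i\<in>{1..n}. borel)"
  unfolding sample_mean_def by measurable

text \<open>The sum of the coordinates is normal with mean \<open>n * \<theta>\<close> and variance
  \<open>n\<close>, so the centred and scaled mean is standard normal.\<close>

lemma prob_sample_mean_le:
  assumes "n \<ge> 1"
  shows "measure (sample_measure n \<theta>) {y \<in> space (sample_measure n \<theta>). sample_mean n y \<le> x}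
    = cdf std_normal_distribution (sqrt (real n) * (x - \<theta>))"
proof -
  define N where "N = density lborel (normal_density \<theta> 1)"
  interpret prob_space "sample_measure n \<theta>" by (rule prob_space_sample_measure)
  have N: "prob_space N"
    unfolding N_def by (rule prob_space_normal_density) simp
  have PiM: "sample_measure n \<theta> = (\<Pi>\<^sub>M i\<in>{1..n}. N)"
    by (simp add: sample_measure_def N_def)
  have distr_coord: "distr (sample_measure n \<theta>) N (\<lambda>y. y i) = N" if "i \<in> {1..n}" for i
    unfolding PiM by (rule distr_PiM_component) (use N that in auto)
  have coord [measurable]: "(\<lambda>y. y i) \<in> borel_measurable (sample_measure n \<theta>)" if "i \<in> {1..n}" for i
    using that unfolding measurable_cong_sets[OF sets_sample_measure refl] by measurable
  \<comment> \<open>Independence amounts to the joint law of the coordinates being the product of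
    their laws. Here the joint law is the sample measure itself, since \<open>restrict\<close> is
    the identity on extensional functions.\<close>
  have indep: "indep_vars (\<lambda>i. borel) (\<lambda>i y. y i) {1..n}"
  proof (subst indep_vars_iff_distr_eq_PiM')
    have "distr (sample_measure n \<theta>) (\<Pi>\<^sub>M i\<in>{1..n}. borel) (\<lambda>x. restrict x {1..n})
        = distr (sample_measure n \<theta>) (sample_measure n \<theta>) (\<lambda>x. x)"
      by (rule distr_cong[OF refl sets_sample_measure[symmetric]])
        (auto simp: PiM space_PiM PiE_iff extensional_restrict)
    also have "\<dots> = (\<Pi>\<^sub>M i\<in>{1..n}. N)"
      by (simp add: PiM)
    also have "\<dots> = (\<Pi>\<^sub>M i\<in>{1..n}. distr (sample_measure n \<theta>) borel (\<lambda>y. y i))"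
    proof (rule PiM_cong)
      fix i assume "i \<in> {1..n}"
      then show "N = distr (sample_measure n \<theta>) borel (\<lambda>y. y i)"
        using distr_coord[of i] by (simp add: N_def cong: distr_cong)
    qed simp
    finally show "distr (sample_measure n \<theta>) (\<Pi>\<^sub>M i\<in>{1..n}. borel) (\<lambda>x. \<lambda>i\<in>{1..n}. x i)
        = (\<Pi>\<^sub>M i\<in>{1..n}. distr (sample_measure n \<theta>) borel (\<lambda>y. y i))" .
  qed (use assms in auto)
  have "distributed (sample_measure n \<theta>) lborel (\<lambda>y. y i) (normal_density \<theta> 1)" if "i \<in> {1..n}" for i
    using distr_coord[OF that] coord[OF that]
    by (simp add: distributed_def N_def cong: distr_cong)
  then have "distributed (sample_measure n \<theta>) lborel (\<lambda>y. \<Sum>i\<in>{1..n}. y i)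
      (normal_density (\<Sum>i\<in>{1..n}. \<theta>) (sqrt (\<Sum>i\<in>{1..n}. 1\<^sup>2)))"
    using indep assms by (intro sum_indep_normal) auto
  then have "distributed (sample_measure n \<theta>) lborel (\<lambda>y. \<Sum>i\<in>{1..n}. y i)
      (normal_density (real n * \<theta>) (sqrt (real n)))"
    by simp
  then have Z: "distributed (sample_measure n \<theta>) lborel
      (\<lambda>y. ((\<Sum>i\<in>{1..n}. y i) - real n * \<theta>) / sqrt (real n)) std_normal_density"
    using assms by (subst (asm) normal_standard_normal_convert) auto
  have eq: "((\<Sum>i\<in>{1..n}. y i) - real n * \<theta>) / sqrt (real n)
      = sqrt (real n) * (sample_mean n y - \<theta>)" for y
    using assms by (simp add: sample_mean_def field_simps)
  have distr_Z: "distr (sample_measure n \<theta>) lborel (\<lambda>y. sqrt (real n) * (sample_mean n y - \<theta>))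
      = std_normal_distribution"
    and Z_meas: "(\<lambda>y. sqrt (real n) * (sample_mean n y - \<theta>)) \<in> measurable (sample_measure n \<theta>) lborel"
    using Z unfolding eq distributed_def by auto
  have "cdf std_normal_distribution (sqrt (real n) * (x - \<theta>))
      = measure (sample_measure n \<theta>) ((\<lambda>y. sqrt (real n) * (sample_mean n y - \<theta>))
          -` {..sqrt (real n) * (x - \<theta>)} \<inter> space (sample_measure n \<theta>))"
    unfolding cdf_def distr_Z[symmetric] by (rule measure_distr[OF Z_meas]) simp
  also have "\<dots> = measure (sample_measure n \<theta>)
      {y \<in> space (sample_measure n \<theta>). sample_mean n y \<le> x}"
    using assms by (intro arg_cong[where f="measure _"]) auto
  finally show ?thesis ..
qed

section \<open>The normal cdf on the extended reals\<close>

text \<open>A cdf is continuous at every point without mass, and a measure with a Lebesgue density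
  has no atoms.\<close>

lemma isCont_cdf_std_normal: "isCont (cdf std_normal_distribution) x"
proof -
  interpret real_distribution std_normal_distribution by (rule real_dist_normal_dist)
  have "emeasure std_normal_distribution {x} = 0"
    by (subst emeasure_density) (auto intro!: nn_integral_0_iff_AE[THEN iffD2] AE_lborel_singleton
        simp: nn_integral_indicator_singleton)
  then show ?thesis
    by (simp add: isCont_cdf measure_def)
qed

text \<open>Finite limits use continuity of the cdf, infinite ones its limits at both ends. The
  infinite cases serve \<open>e = \<infinity>\<close> in the asymptotic bound.\<close>

lemma tendsto_Phi:
  assumes "(\<lambda>n. ereal (x n)) \<longlonglongrightarrow> z"
  shows "(\<lambda>n. Phi (ereal (x n))) \<longlonglongrightarrow> Phi z"
proof -
  interpret real_distribution std_normal_distribution by (rule real_dist_normal_dist)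
  show ?thesis
  proof (cases z)
    case (real r)
    then show ?thesis
      using assms isCont_tendsto_compose[OF isCont_cdf_std_normal] by (simp add: Phi_def)
  next
    case PInf
    then have "filterlim x at_top sequentially"
      using assms by (simp add: tendsto_PInfty_eq_at_top)
    then show ?thesis
      using PInf filterlim_compose[OF cdf_lim_at_top_prob] by (simp add: Phi_def)
  next
    case MInf
    then have "filterlim x at_bot sequentially"
      using assms by (simp add: tendsto_MInfty filterlim_at_bot_dense)
    then show ?thesis
      using MInf filterlim_compose[OF cdf_lim_at_bot] by (simp add: Phi_def)
  qed
qed

section \<open>Common properties of the thresholding estimators\<close>

text \<open>Together the two claims force the estimate to vanish when the mean lies in
  \<open>[-\<eta>, \<eta>]\<close>. Apart from measurability, this sign behaviour is all that the
  bound uses about the three estimators.\<close>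

lemma thresholding_estimator_sign:
  assumes "a > 2" "\<eta> > 0" "est \<in> {hard_est, soft_est, scad_est a}"
  shows "sample_mean n y \<le> \<eta> \<Longrightarrow> est n \<eta> y \<le> 0"
    and "- \<eta> \<le> sample_mean n y \<Longrightarrow> 0 \<le> est n \<eta> y"
proof -
  define m where "m = sample_mean n y"
  \<comment> \<open>\<open>neg\<close> and \<open>pos\<close> handle the middle piece of SCAD:
    beyond \<open>2 * \<eta>\<close> its numerator keeps the sign of \<open>m\<close>, because 2(a -
    1) - a = a - 2 > 0.\<close>
  have neg: "(a - 1) * m + a * \<eta> \<le> 0" if "m < - (2 * \<eta>)"
  proof -
    have "(a - 1) * m \<le> (a - 1) * (- (2 * \<eta>))"
      using that assms by (intro mult_left_mono) auto
    moreover have "0 \<le> (a - 2) * \<eta>" using assms by simp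
    ultimately show ?thesis by (simp add: algebra_simps)
  qed
  have pos: "0 \<le> (a - 1) * m - a * \<eta>" if "2 * \<eta> < m"
  proof -
    have "(a - 1) * (2 * \<eta>) \<le> (a - 1) * m"
      using that assms by (intro mult_left_mono) auto
    moreover have "0 \<le> (a - 2) * \<eta>" using assms by simp
    ultimately show ?thesis by (simp add: algebra_simps)
  qed
  show "est n \<eta> y \<le> 0" if "sample_mean n y \<le> \<eta>"
    using assms that neg
    by (auto simp: hard_est_def soft_est_def scad_est_def Let_def m_def sgn_real_def divide_nonpos_pos
        split: if_splits)
  show "0 \<le> est n \<eta> y" if "- \<eta> \<le> sample_mean n y"
    using assms that pos
    by (auto simp: hard_est_def soft_est_def scad_est_def Let_def m_def sgn_real_def divide_nonneg_pos
        split: if_splits)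
qed

lemma measurable_thresholding_estimator:
  assumes "est \<in> {hard_est, soft_est, scad_est a}"
  shows "est n \<eta> \<in> borel_measurable (\<Pi>\<^sub>M i\<in>{1..n}. borel)"
proof -
  have "hard_est n \<eta> \<in> borel_measurable (\<Pi>\<^sub>M i\<in>{1..n}. borel)"
    unfolding hard_est_def by measurable
  moreover have "soft_est n \<eta> \<in> borel_measurable (\<Pi>\<^sub>M i\<in>{1..n}. borel)"
    unfolding soft_est_def by measurable
  moreover have "scad_est a n \<eta> \<in> borel_measurable (\<Pi>\<^sub>M i\<in>{1..n}. borel)"
    unfolding scad_est_def Let_def by measurable
  ultimately show ?thesis using assms by auto
qed

lemma est_cdf_eq:
  assumes "est \<in> {hard_est, soft_est, scad_est a}"
  shows "est_cdf est \<eta> n \<theta> t = measure (sample_measure n \<theta>)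
    {y \<in> space (sample_measure n \<theta>). sqrt (real n) * (est n \<eta> y - \<theta>) \<le> t}"
proof -
  have [measurable]: "est n \<eta> \<in> borel_measurable (sample_measure n \<theta>)"
    using measurable_thresholding_estimator[OF assms]
    by (simp add: measurable_cong_sets[OF sets_sample_measure refl])
  show ?thesis
    unfolding est_cdf_def cdf_def
    by (subst measure_distr) (auto intro!: arg_cong[where f="measure _"])
qed

section \<open>The bound at a fixed sample size\<close>

lemma minimax_error_prob_ge_half:
  assumes "a > 2" and est: "est \<in> {hard_est, soft_est, scad_est a}" and "\<eta> > 0" "n \<ge> 1"
    and Fhat: "Fhat \<in> estimators n"
    and \<epsilon>: "\<epsilon> < (Phi (ereal (t + sqrt (real n) * \<eta>)) - Phi (ereal (t - sqrt (real n) * \<eta>))) / 2"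
    and "c > \<bar>t\<bar>"
  shows "(SUP \<theta>\<in>{\<theta>. \<bar>\<theta>\<bar> < c / sqrt (real n)}. ereal (error_prob est \<eta> n \<theta> t Fhat \<epsilon>)) \<ge> ereal (1 / 2)"
    (is "?S \<ge> _")
proof -
  define s where "s = sqrt (real n)"
  \<comment> \<open>The threshold at which the estimate 0 enters the event:
    \<open>s * (0 - \<theta>) \<le> t\<close> holds exactly when \<theta> is at least
    \<open>\<theta>0\<close>.\<close>
  define \<theta>0 where "\<theta>0 = - t / s"
  define P where "P = sample_measure n"
  define X where "X = space (\<Pi>\<^sub>M i\<in>{1..n}. borel :: real measure)"
  define up where "up = cdf std_normal_distribution (t + s * \<eta>)"
  define lo where "lo = cdf std_normal_distribution (t - s * \<eta>)"
  define q where "q = (up + lo) / 2"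
  define B where "B = {y \<in> X. Fhat y \<le> q}"
  \<comment> \<open>The estimate is at most 0 on \<open>U\<close> and at least 0 off
    \<open>V\<close>.\<close>
  define U where "U = {y \<in> X. sample_mean n y \<le> \<eta>}"
  define V where "V = {y \<in> X. sample_mean n y \<le> - \<eta>}"
  have s: "s > 0" using \<open>n \<ge> 1\<close> by (simp add: s_def)
  have space_P: "space (P \<theta>) = X" for \<theta>
    unfolding P_def X_def by (rule sets_eq_imp_space_eq[OF sets_sample_measure])
  have sets_P: "sets (P \<theta>) = sets (\<Pi>\<^sub>M i\<in>{1..n}. borel)" for \<theta>
    unfolding P_def by (rule sets_sample_measure)
  have prob_P: "prob_space (P \<theta>)" for \<theta>
    unfolding P_def by (rule prob_space_sample_measure)
  have Fhat_meas [measurable]: "Fhat \<in> borel_measurable (\<Pi>\<^sub>M i\<in>{1..n}. borel)"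
    using Fhat by (simp add: estimators_def)
  have est_meas [measurable]: "est n \<eta> \<in> borel_measurable (\<Pi>\<^sub>M i\<in>{1..n}. borel)"
    by (rule measurable_thresholding_estimator[OF est])
  have B: "B \<in> sets (\<Pi>\<^sub>M i\<in>{1..n}. borel)" and U: "U \<in> sets (\<Pi>\<^sub>M i\<in>{1..n}. borel)"
    and V: "V \<in> sets (\<Pi>\<^sub>M i\<in>{1..n}. borel)"
    unfolding B_def U_def V_def X_def by measurable
  have cont: "((\<lambda>\<theta>. measure (P \<theta>) A) \<longlongrightarrow> measure (P \<theta>0) A) (at \<theta>0)"
    if "A \<in> sets (\<Pi>\<^sub>M i\<in>{1..n}. borel)" for A
    using isCont_measure_sample_measure[OF that, of \<theta>0] unfolding P_def isCont_def .
  \<comment> \<open>At \<open>\<theta>0\<close> the standardised cut points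
    \<open>s * (\<eta> - \<theta>0)\<close> and \<open>s * (- \<eta> - \<theta>0)\<close> are
    \<open>t + s * \<eta>\<close> and \<open>t - s * \<eta>\<close>.\<close>
  have PU: "measure (P \<theta>0) U = up" and PV: "measure (P \<theta>0) V = lo"
    using prob_sample_mean_le[OF \<open>n \<ge> 1\<close>, of \<theta>0] s
    unfolding U_def V_def space_P[symmetric, of \<theta>0] P_def up_def lo_def \<theta>0_def s_def
    by (simp_all add: field_simps)
  \<comment> \<open>Both gaps \<open>up - q\<close> and \<open>q - lo\<close> equal half of
    \<open>up - lo\<close>, so the hypothesis on \<epsilon> makes both strict. The strictness is
    what survives a small move of \<theta> away from \<open>\<theta>0\<close>.\<close>
  have q: "q + \<epsilon> < up" "lo < q - \<epsilon>"
    using \<epsilon> by (simp_all add: q_def up_def lo_def Phi_def s_def field_simps)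
  have cdf: "est_cdf est \<eta> n \<theta> t = measure (P \<theta>) {y \<in> X. s * (est n \<eta> y - \<theta>) \<le> t}" for \<theta>
    using est_cdf_eq[OF est] space_P[of \<theta>] by (simp add: P_def s_def)
  have err: "error_prob est \<eta> n \<theta> t Fhat \<epsilon>
      = measure (P \<theta>) {y \<in> X. \<bar>Fhat y - est_cdf est \<eta> n \<theta> t\<bar> > \<epsilon>}" for \<theta>
    using space_P[of \<theta>] by (simp add: error_prob_def P_def)
  have cdf_meas: "{y \<in> X. s * (est n \<eta> y - \<theta>) \<le> t} \<in> sets (P \<theta>)" for \<theta>
    unfolding X_def sets_P by measurable
  have err_meas: "{y \<in> X. \<bar>Fhat y - r\<bar> > \<epsilon>} \<in> sets (P \<theta>)" for \<theta> r
    unfolding X_def sets_P by measurable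
  \<comment> \<open>Right of \<open>\<theta>0\<close>, \<open>- s * \<theta> < t\<close>, so every
    nonpositive estimate falls into the event.\<close>
  have cdf_right: "measure (P \<theta>) U \<le> est_cdf est \<eta> n \<theta> t" if "\<theta>0 < \<theta>" for \<theta>
  proof -
    interpret prob_space "P \<theta>" by (rule prob_P)
    have "- t < s * \<theta>" using that s by (simp add: \<theta>0_def field_simps)
    moreover have "s * est n \<eta> y \<le> 0" if "y \<in> U" for y
      using that s thresholding_estimator_sign(1)[OF \<open>a > 2\<close> \<open>\<eta> > 0\<close> est, of n y]
      by (simp add: U_def mult_nonneg_nonpos)
    ultimately have "U \<subseteq> {y \<in> X. s * (est n \<eta> y - \<theta>) \<le> t}"
      by (fastforce simp: U_def algebra_simps)
    then show ?thesis
      unfolding cdf using cdf_meas by (rule finite_measure_mono)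
  qed
  \<comment> \<open>Left of \<open>\<theta>0\<close>, \<open>- s * \<theta> > t\<close>, so the
    event requires a negative estimate and hence a sample in \<open>V\<close>.\<close>
  have cdf_left: "est_cdf est \<eta> n \<theta> t \<le> measure (P \<theta>) V" if "\<theta> < \<theta>0" for \<theta>
  proof -
    interpret prob_space "P \<theta>" by (rule prob_P)
    have "s * \<theta> < - t" using that s by (simp add: \<theta>0_def field_simps)
    have "sample_mean n y \<le> - \<eta>" if "s * (est n \<eta> y - \<theta>) \<le> t" for y
    proof (rule ccontr)
      assume "\<not> ?thesis"
      then have "0 \<le> s * est n \<eta> y"
        using s thresholding_estimator_sign(2)[OF \<open>a > 2\<close> \<open>\<eta> > 0\<close> est, of n y] by simp
      with that \<open>s * \<theta> < - t\<close> show False by (simp add: algebra_simps)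
    qed
    then have "{y \<in> X. s * (est n \<eta> y - \<theta>) \<le> t} \<subseteq> V"
      by (auto simp: V_def)
    moreover have "V \<in> sets (P \<theta>)" using V by (simp add: sets_P)
    ultimately show ?thesis
      unfolding cdf by (rule finite_measure_mono)
  qed
  \<comment> \<open>As \<open>c > \<bar>t\<bar>\<close>, \<open>\<theta>0\<close> is interior to the
    range of the supremum, which therefore bounds the error probability at all nearby
    \<theta>.\<close>
  have "\<bar>\<theta>0\<bar> < c / s"
    using \<open>c > \<bar>t\<bar>\<close> s by (simp add: \<theta>0_def divide_strict_right_mono)
  then have "\<forall>\<^sub>F \<theta> in at \<theta>0. \<bar>\<theta>\<bar> < c / s"
    by (intro order_tendstoD(2)[OF tendsto_rabs[OF tendsto_ident_at]])
  then have S: "\<forall>\<^sub>F \<theta> in at \<theta>0. ereal (error_prob est \<eta> n \<theta> t Fhat \<epsilon>) \<le> ?S"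
    by eventually_elim (auto intro!: SUP_upper simp: s_def)
  have "\<forall>\<^sub>F \<theta> in at_right \<theta>0. ereal (measure (P \<theta>) B) \<le> ?S"
  proof -
    have "\<forall>\<^sub>F \<theta> in at \<theta>0. q + \<epsilon> < measure (P \<theta>) U"
      using cont[OF U] q(1) unfolding PU by (rule order_tendstoD)
    with S have "\<forall>\<^sub>F \<theta> in at_right \<theta>0. q + \<epsilon> < measure (P \<theta>) U
        \<and> ereal (error_prob est \<eta> n \<theta> t Fhat \<epsilon>) \<le> ?S"
      unfolding eventually_at_split by (auto intro: eventually_conj)
    moreover have "\<forall>\<^sub>F \<theta> in at_right \<theta>0. \<theta>0 < \<theta>"
      by (auto simp: eventually_at_filter)
    ultimately show ?thesis
    proof eventually_elim
      case (elim \<theta>)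
      interpret prob_space "P \<theta>" by (rule prob_P)
      \<comment> \<open>On \<open>B\<close> the estimate of the cdf is at most \<open>q\<close>,
        while the cdf itself is at least the measure of \<open>U\<close>, above
        \<open>q + \<epsilon>\<close>.\<close>
      have "B \<subseteq> {y \<in> X. \<bar>Fhat y - est_cdf est \<eta> n \<theta> t\<bar> > \<epsilon>}"
        using elim cdf_right[of \<theta>] by (auto simp: B_def)
      then have "measure (P \<theta>) B \<le> error_prob est \<eta> n \<theta> t Fhat \<epsilon>"
        unfolding err using err_meas by (rule finite_measure_mono)
      with elim show ?case by (meson ereal_less_eq(3) order_trans)
    qed
  qed
  moreover have "((\<lambda>\<theta>. ereal (measure (P \<theta>) B)) \<longlongrightarrow> ereal (measure (P \<theta>0) B)) (at_right \<theta>0)"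
    using cont[OF B] by (intro tendsto_ereal) (auto simp: filterlim_at_split)
  \<comment> \<open>The bound holds only to the right of \<open>\<theta>0\<close>; continuity of the
    probability of \<open>B\<close> carries it to \<open>\<theta>0\<close>.\<close>
  ultimately have right: "ereal (measure (P \<theta>0) B) \<le> ?S"
    by (intro tendsto_upperbound) auto
  have "\<forall>\<^sub>F \<theta> in at_left \<theta>0. ereal (1 - measure (P \<theta>) B) \<le> ?S"
  proof -
    have "\<forall>\<^sub>F \<theta> in at \<theta>0. measure (P \<theta>) V < q - \<epsilon>"
      using cont[OF V] q(2) unfolding PV by (rule order_tendstoD)
    with S have "\<forall>\<^sub>F \<theta> in at_left \<theta>0. measure (P \<theta>) V < q - \<epsilon>
        \<and> ereal (error_prob est \<eta> n \<theta> t Fhat \<epsilon>) \<le> ?S"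
      unfolding eventually_at_split by (auto intro: eventually_conj)
    moreover have "\<forall>\<^sub>F \<theta> in at_left \<theta>0. \<theta> < \<theta>0"
      by (auto simp: eventually_at_filter)
    ultimately show ?thesis
    proof eventually_elim
      case (elim \<theta>)
      interpret prob_space "P \<theta>" by (rule prob_P)
      have "1 - measure (P \<theta>) B = measure (P \<theta>) (X - B)"
        using prob_compl[of B] B by (simp add: space_P sets_P)
      also have "\<dots> \<le> error_prob est \<eta> n \<theta> t Fhat \<epsilon>"
        unfolding err
      proof (rule finite_measure_mono[OF _ err_meas])
        \<comment> \<open>Off \<open>B\<close> the estimate exceeds \<open>q\<close>, while the cdf
          is at most the measure of \<open>V\<close>, below \<open>q - \<epsilon>\<close>.\<close>
        show "X - B \<subseteq> {y \<in> X. \<bar>Fhat y - est_cdf est \<eta> n \<theta> t\<bar> > \<epsilon>}"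
          using elim cdf_left[of \<theta>] by (auto simp: B_def)
      qed
      finally show ?case using elim by (meson ereal_less_eq(3) order_trans)
    qed
  qed
  moreover have "((\<lambda>\<theta>. ereal (1 - measure (P \<theta>) B)) \<longlongrightarrow> ereal (1 - measure (P \<theta>0) B)) (at_left \<theta>0)"
    using cont[OF B] by (intro tendsto_ereal tendsto_intros) (auto simp: filterlim_at_split)
  ultimately have left: "ereal (1 - measure (P \<theta>0) B) \<le> ?S"
    by (intro tendsto_upperbound) auto
  have "ereal (1 / 2) \<le> ereal (measure (P \<theta>0) B) \<or> ereal (1 / 2) \<le> ereal (1 - measure (P \<theta>0) B)"
    by auto
  with left right show ?thesis by (meson order_trans)
qed

section \<open>Finite-sample and asymptotic forms of the bound\<close>

theorem theorem16:
  fixes a t :: real and \<eta> :: "nat \<Rightarrow> real"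
    and est :: "nat \<Rightarrow> real \<Rightarrow> (nat \<Rightarrow> real) \<Rightarrow> real"
  assumes "a > 2"
    and "est \<in> {hard_est, soft_est, scad_est a}"
    and "\<And>n. n \<ge> 1 \<Longrightarrow> \<eta> n > 0"
  shows "(\<forall>n\<ge>1. \<forall>Fhat \<in> estimators n. \<forall>\<epsilon> c.
            \<epsilon> < (Phi (ereal (t + sqrt (real n) * \<eta> n)) - Phi (ereal (t - sqrt (real n) * \<eta> n))) / 2 \<longrightarrow>
            c > \<bar>t\<bar> \<longrightarrow>
            (SUP \<theta>\<in>{\<theta>. \<bar>\<theta>\<bar> < c / sqrt (real n)}. ereal (error_prob est (\<eta> n) n \<theta> t Fhat \<epsilon>))
              \<ge> ereal (1 / 2))
       \<and> (\<forall>e::ereal. 0 \<le> e \<longrightarrow> \<eta> \<longlonglongrightarrow> 0 \<longrightarrow> (\<lambda>n. ereal (sqrt (real n) * \<eta> n)) \<longlonglongrightarrow> e \<longrightarrow>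
            (\<forall>\<epsilon> c. \<epsilon> < (Phi (ereal t + e) - Phi (ereal t - e)) / 2 \<longrightarrow> c > \<bar>t\<bar> \<longrightarrow>
               liminf (\<lambda>n. INF Fhat\<in>estimators n.
                  SUP \<theta>\<in>{\<theta>. \<bar>\<theta>\<bar> < c / sqrt (real n)}. ereal (error_prob est (\<eta> n) n \<theta> t Fhat \<epsilon>))
                 \<ge> ereal (1 / 2)))"
proof (intro conjI allI ballI impI)
  fix n Fhat \<epsilon> c
  assume "n \<ge> 1" "Fhat \<in> estimators n" "c > \<bar>t\<bar>"
    "\<epsilon> < (Phi (ereal (t + sqrt (real n) * \<eta> n)) - Phi (ereal (t - sqrt (real n) * \<eta> n))) / 2"
  then show "(SUP \<theta>\<in>{\<theta>. \<bar>\<theta>\<bar> < c / sqrt (real n)}. ereal (error_prob est (\<eta> n) n \<theta> t Fhat \<epsilon>))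
      \<ge> ereal (1 / 2)"
    using assms by (intro minimax_error_prob_ge_half[where a=a]) auto
next
  fix e :: ereal and \<epsilon> c
  assume e: "0 \<le> e" "(\<lambda>n. ereal (sqrt (real n) * \<eta> n)) \<longlonglongrightarrow> e"
    and \<epsilon>: "\<epsilon> < (Phi (ereal t + e) - Phi (ereal t - e)) / 2" and "c > \<bar>t\<bar>"
  \<comment> \<open>Since \<open>t\<close> is finite, neither sum has the form \<infinity> -
    \<infinity>, even for \<open>e = \<infinity>\<close>.\<close>
  have "(\<lambda>n. ereal t + ereal (sqrt (real n) * \<eta> n)) \<longlonglongrightarrow> ereal t + e"
    using e by (intro tendsto_add_ereal_general2 tendsto_const) auto
  moreover have "(\<lambda>n. ereal t - ereal (sqrt (real n) * \<eta> n)) \<longlonglongrightarrow> ereal t - e"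
    using e unfolding minus_ereal_def
    by (intro tendsto_add_ereal_general2 tendsto_const tendsto_uminus_ereal) auto
  ultimately have "(\<lambda>n. (Phi (ereal (t + sqrt (real n) * \<eta> n)) - Phi (ereal (t - sqrt (real n) * \<eta> n))) / 2)
      \<longlonglongrightarrow> (Phi (ereal t + e) - Phi (ereal t - e)) / 2"
    by (intro tendsto_intros tendsto_Phi) auto
  \<comment> \<open>The limit lies strictly above \<epsilon>, so the finite-sample condition on
    \<epsilon> holds for all large \<open>n\<close>. The fixed-\<open>n\<close> bound then applies
    to every estimator and passes to the infimum.\<close>
  then have "\<forall>\<^sub>F n in sequentially.
      \<epsilon> < (Phi (ereal (t + sqrt (real n) * \<eta> n)) - Phi (ereal (t - sqrt (real n) * \<eta> n))) / 2"
    using \<epsilon> by (rule order_tendstoD)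
  then have "\<forall>\<^sub>F n in sequentially. ereal (1 / 2) \<le> (INF Fhat\<in>estimators n.
      SUP \<theta>\<in>{\<theta>. \<bar>\<theta>\<bar> < c / sqrt (real n)}. ereal (error_prob est (\<eta> n) n \<theta> t Fhat \<epsilon>))"
    using eventually_ge_at_top[of 1]
  proof eventually_elim
    case (elim n)
    then show ?case
      using assms \<open>c > \<bar>t\<bar>\<close> by (intro INF_greatest minimax_error_prob_ge_half[where a=a]) auto
  qed
  then show "liminf (\<lambda>n. INF Fhat\<in>estimators n.
      SUP \<theta>\<in>{\<theta>. \<bar>\<theta>\<bar> < c / sqrt (real n)}. ereal (error_prob est (\<eta> n) n \<theta> t Fhat \<epsilon>)) \<ge> ereal (1 / 2)"
    by (rule Liminf_bounded)
qed

end
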